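(* Let $K$ be a field, let $\mathcal{I} \subset \mathbb{N}^2$ be an interval of $\mathbb{N}^2$, and let $\mathcal{P}_{\mathcal{I}}$ be the polyomino consisting of all cells of $\mathbb{N}^2$ contained in $\mathcal{I}$. Let $\mathcal{P}$ be a simple polyomino which is a subpolyomino of $\mathcal{P}_{\mathcal{I}}$. Let $\mathcal{P}^c = \mathcal{P}_{\mathcal{I}} \setminus \mathcal{P}$ be the collection of those cells of $\mathcal{P}_{\mathcal{I}}$ which do not belong to $\mathcal{P}$, and suppose that $\mathcal{P}^c$ is a polyomino. Then the polyomino ideal $I_{\mathcal{P}^c} \subset K[x_v : v\in V(\mathcal{P}^c)]$ cannot come from a finite simple graph; that is, $I_{\mathcal{P}^c}$ does not coincide with the toric ideal $I_G$ of any finite simple graph $G$ (where the variables $x_v$, $v \in V(\mathcal{P}^c)$, are identified with the variables indexed by the edges of $G$ via some bijection between $V(\mathcal{P}^c)$ and $E(G)$).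
   Context: $\mathbb{N}$ is the set of nonnegative integers and $\mathbb{N}^2=\{(i,j): i,j\in\mathbb{N}\}$, with the componentwise partial order $\leq$. For $a=(i,j)$ and $b=(k,\ell)$ in $\mathbb{N}^2$ write $a<b$ if $i<k$ and $j<\ell$. When $a<b$, the interval $[a,b]$ is $\{c\in\mathbb{N}^2 : a\leq c\leq b\}$; its diagonal corners are $a,b$ and its anti-diagonal corners are $(i,\ell)$ and $(k,j)$. A cell with lower left corner $a\in\mathbb{N}^2$ is the interval $C=[a,a+(1,1)]$. Its vertices are $a,\ a+(1,0),\ a+(0,1),\ a+(1,1)$, and its edges are $\{a,a+(1,0)\}$, $\{a,a+(0,1)\}$, $\{a+(1,0),a+(1,1)\}$, $\{a+(0,1),a+(1,1)\}$. For a finite collection $\mathcal{P}$ of cells, $V(\mathcal{P})$ is the set of all vertices of its cells. A path of cells is a sequence $C_1,\ldots,C_m$ of pairwise distinct cells such that $C_i\cap C_{i+1}$ is an edge of $C_i$ for $i=1,\ldots,m-1$. A finite collection $\mathcal{P}$ of cells is a polyomino if any two cells of $\mathcal{P}$ can be joined by a path of cells of $\mathcal{P}$. A polyomino $\mathcal{Q}$ is a subpolyomino of $\mathcal{P}$ if each cell of $\mathcal{Q}$ belongs to $\mathcal{P}$. For an interval $[a,b]$, $\mathcal{P}_{[a,b]}$ denotes the polyomino consisting of all cells contained in $[a,b]$. A polyomino $\mathcal{P}$, contained in $\mathcal{P}_{[a,b]}$ for an interval $[a,b]$, is simple if for any cell $C$ of $\mathbb{N}^2$ not belonging to $\mathcal{P}$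 there is a path of cells $C=C_1,C_2,\ldots,C_m=D$ with each $C_i\notin\mathcal{P}$ such that $D$ is not a cell of $\mathcal{P}_{[a,b]}$ (roughly, $\mathcal{P}$ has no hole). For a finite collection $\mathcal{P}$ of cells and a field $K$, let $S$ be the polynomial ring over $K$ in the variables $x_v$, $v\in V(\mathcal{P})$. An interval $[a,b]$ of $\mathbb{N}^2$ is an interval of $\mathcal{P}$ if $\mathcal{P}_{[a,b]}\subset\mathcal{P}$. For each interval $[a,b]$ of $\mathcal{P}$, with anti-diagonal corners $c,d$, the binomial $f_{a,b}=x_ax_b-x_cx_d$ is called an inner $2$-minor of $\mathcal{P}$. $I_{\mathcal{P}}\subset S$ is the ideal generated by all inner $2$-minors of $\mathcal{P}$; when $\mathcal{P}$ is a polyomino it is called the polyomino ideal of $\mathcal{P}$. For a finite simple graph $G$ (no loops, no multiple edges) with vertex set $V(G)$ and edge set $E(G)$, the toric ideal $I_G$ is the kernel of the $K$-algebra homomorphism $K[x_e : e\in E(G)]\to K[t_i : i\in V(G)]$ sending $x_e\mapsto t_it_j$ for $e=\{i,j\}$; its image is the edge ring $K[G]$. A binomial ideal is said to come from a finite simple graph if it coincides with the toric ideal arising from a finite simple graph.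
   Formalization: The polyomino P is additionally assumed nonempty with no vertex on the boundary of the interval I; otherwise the claim fails, e.g. when I consists of two cells and P is one of them, the ideal of P^c is the toric ideal of the 4-cycle. *)

theory Defs
  imports
    "HOL-Library.Poly_Mapping"
    "HOL-Library.Product_Plus"
    "HOL-Library.Product_Order"
    "HOL-Algebra.RingHom"
begin

subsection \<open>Intervals, cells and polyominoes\<close>

text \<open>
  Points of the lattice carry the componentwise order of \<^theory>\<open>HOL-Library.Product_Order\<close>, so
  \<open>{a..b}\<close> is the interval $[a,b]$.  The strict order of that theory only requires
  \<open>a \<le> b\<close> and \<open>a \<noteq> b\<close>; the relation $a<b$ used for polyominoes is strict in both coordinates.
\<close>

type_synonym point = "nat \<times> nat"

definition strictly_below :: "point \<Rightarrow> point \<Rightarrow> bool" (infix \<open>\<prec>\<close> 50) where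
  "a \<prec> b \<longleftrightarrow> fst a < fst b \<and> snd a < snd b"

definition cell :: "point \<Rightarrow> point set" where
  "cell a = {a..a + (1, 1)}"

definition is_cell :: "point set \<Rightarrow> bool" where
  "is_cell C \<longleftrightarrow> (\<exists>a. C = cell a)"

definition cell_edges :: "point set \<Rightarrow> point set set" where
  "cell_edges C = {e. \<exists>a. C = cell a \<and>
     e \<in> {{a, a + (1, 0)}, {a, a + (0, 1)},
          {a + (1, 0), a + (1, 1)}, {a + (0, 1), a + (1, 1)}}}"

text \<open>Since intervals consist of lattice points only, a cell is the set of its four vertices.\<close>

definition vertices :: "point set set \<Rightarrow> point set" where
  "vertices P = \<Union>P"

definition cell_path :: "point set list \<Rightarrow> bool" where
  "cell_path Cs \<longleftrightarrow> Cs \<noteq> [] \<and> distinct Cs \<and> (\<forall>C\<in>set Cs. is_cell C) \<and>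
     (\<forall>i. Suc i < length Cs \<longrightarrow> Cs ! i \<inter> Cs ! Suc i \<in> cell_edges (Cs ! i))"

definition polyomino :: "point set set \<Rightarrow> bool" where
  "polyomino P \<longleftrightarrow> finite P \<and> (\<forall>C\<in>P. is_cell C) \<and>
     (\<forall>C\<in>P. \<forall>D\<in>P. \<exists>Cs. cell_path Cs \<and> set Cs \<subseteq> P \<and> hd Cs = C \<and> last Cs = D)"

definition subpolyomino :: "point set set \<Rightarrow> point set set \<Rightarrow> bool" where
  "subpolyomino Q P \<longleftrightarrow> polyomino Q \<and> Q \<subseteq> P"

definition cells_in :: "point \<Rightarrow> point \<Rightarrow> point set set" where
  "cells_in a b = {C. is_cell C \<and> C \<subseteq> {a..b}}"

definition simple_polyomino :: "point set set \<Rightarrow> bool" where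
  "simple_polyomino P \<longleftrightarrow> polyomino P \<and>
     (\<exists>a b. a \<prec> b \<and> P \<subseteq> cells_in a b \<and>
       (\<forall>C. is_cell C \<and> C \<notin> P \<longrightarrow>
         (\<exists>Cs. cell_path Cs \<and> set Cs \<inter> P = {} \<and> hd Cs = C \<and> last Cs \<notin> cells_in a b)))"

text \<open>
  No vertex of \<open>P\<close> lies on the boundary of the rectangle $[a,b]$.  If a polyomino
  \<open>P \<subseteq> cells_in a b\<close> is nonempty and satisfies this condition, it is a hole of the complement
  \<open>cells_in a b - P\<close>.  If the condition fails or \<open>P\<close> is empty, then the complement can have an
  ideal coming from a graph: for $a=(0,0)$, $b=(2,1)$ and a single cell \<open>P\<close> the complement is a
  single cell, whose ideal is the toric ideal of the 4-cycle.
\<close>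

definition avoids_boundary :: "point set set \<Rightarrow> point \<Rightarrow> point \<Rightarrow> bool" where
  "avoids_boundary P a b \<longleftrightarrow> (\<forall>v\<in>vertices P. a \<prec> v \<and> v \<prec> b)"

subsection \<open>Polynomial rings\<close>

text \<open>
  A monomial is a finitely supported exponent function and a polynomial is a finitely supported
  coefficient function on monomials.  The product on \<^typ>\<open>('x \<Rightarrow>\<^sub>0 nat) \<Rightarrow>\<^sub>0 'k::field\<close> from
  \<^theory>\<open>HOL-Library.Poly_Mapping\<close> is the product of polynomials.
\<close>

type_synonym ('x, 'k) mpoly = "('x \<Rightarrow>\<^sub>0 nat) \<Rightarrow>\<^sub>0 'k"

definition Const :: "'k \<Rightarrow> ('x, 'k::field) mpoly" where
  "Const c = Poly_Mapping.single 0 c"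

definition Var :: "'x \<Rightarrow> ('x, 'k::field) mpoly" where
  "Var x = Poly_Mapping.single (Poly_Mapping.single x 1) 1"

definition polys_over :: "'x set \<Rightarrow> ('x, 'k::field) mpoly set" where
  "polys_over X = {p. \<forall>m\<in>Poly_Mapping.keys p. Poly_Mapping.keys m \<subseteq> X}"

definition poly_ring :: "'x set \<Rightarrow> ('x, 'k::field) mpoly ring" where
  "poly_ring X = \<lparr>carrier = polys_over X, mult = (*), one = 1, zero = 0, add = (+)\<rparr>"

text \<open>The homomorphism of algebras over the coefficient field that sends each \<open>x\<close> to \<open>g x\<close>.\<close>

definition poly_subst ::
  "('x \<Rightarrow> ('y, 'k) mpoly) \<Rightarrow> ('x, 'k::field) mpoly \<Rightarrow> ('y, 'k) mpoly" where
  "poly_subst g p = (\<Sum>m\<in>Poly_Mapping.keys p. Const (Poly_Mapping.lookup p m) *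
     (\<Prod>x\<in>Poly_Mapping.keys m. g x ^ Poly_Mapping.lookup m x))"

subsection \<open>Polyomino ideals and toric ideals of graphs\<close>

definition inner_minor :: "point \<Rightarrow> point \<Rightarrow> (point, 'k::field) mpoly" where
  "inner_minor a b = Var a * Var b - Var (fst a, snd b) * Var (fst b, snd a)"

definition inner_minors :: "point set set \<Rightarrow> (point, 'k::field) mpoly set" where
  "inner_minors P = {inner_minor a b | a b. a \<prec> b \<and> cells_in a b \<subseteq> P}"

definition polyomino_ideal :: "point set set \<Rightarrow> (point, 'k::field) mpoly set" where
  "polyomino_ideal P = Idl\<^bsub>poly_ring (vertices P)\<^esub> (inner_minors P)"

definition finite_simple_graph :: "'v set \<Rightarrow> 'v set set \<Rightarrow> bool" where
  "finite_simple_graph V E \<longleftrightarrow> finite V \<and> (\<forall>e\<in>E. e \<subseteq> V \<and> card e = 2)"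

text \<open>The variables of the source ring are the edges; \<open>\<Prod>i\<in>e. Var i\<close> is $t_i t_j$ for $e=\{i,j\}$.\<close>

definition toric_ideal :: "'v set \<Rightarrow> 'v set set \<Rightarrow> ('v set, 'k::field) mpoly set" where
  "toric_ideal V E =
     a_kernel (poly_ring E) (poly_ring V :: ('v, 'k) mpoly ring) (poly_subst (\<lambda>e. \<Prod>i\<in>e. Var i))"

text \<open>
  The ideal \<open>I\<close> of the polynomial ring with variables \<open>X\<close> coincides with the toric ideal of the
  graph once the variables are identified with the edges by some bijection.
\<close>

definition coincides_with_toric_ideal ::
  "'x set \<Rightarrow> ('x, 'k::field) mpoly set \<Rightarrow> 'v set \<Rightarrow> 'v set set \<Rightarrow> bool" where
  "coincides_with_toric_ideal X I V E \<longleftrightarrow>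
     (\<exists>\<phi>. bij_betw \<phi> X E \<and> poly_subst (\<lambda>x. Var (\<phi> x)) ` I = toric_ideal V E)"

end

theory Submission
  imports Defs
begin

text \<open>
  If the ideal is toric, the corners of every inner interval are labelled by the edges of a 4-cycle
  of the graph.  Comparing the inner intervals of a boundary strip shows that the labels along one
  side of the rectangle share a graph vertex.  The labels of the four corners of the rectangle
  therefore form a closed walk of length 4, and the binomial on these corners lies in the toric
  ideal.  It does not lie in the polyomino ideal, since the whole rectangle is not an inner interval.
\<close>

subsection \<open>Substitution is a ring homomorphism\<close>

definition monom_subst :: "('x \<Rightarrow> 'r::comm_semiring_1) \<Rightarrow> ('x \<Rightarrow>\<^sub>0 nat) \<Rightarrow> 'r" where
  "monom_subst g m = (\<Prod>x\<in>Poly_Mapping.keys m. g x ^ Poly_Mapping.lookup m x)"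

text \<open>Factors outside the support are zeroth powers, hence 1. A common index set lets two
  monomials and their product be compared factor by factor.\<close>

lemma monom_subst_superset:
  assumes "finite A" "Poly_Mapping.keys m \<subseteq> A"
  shows "monom_subst g m = (\<Prod>x\<in>A. g x ^ Poly_Mapping.lookup m x)"
  unfolding monom_subst_def
  using assms by (intro prod.mono_neutral_left) (auto simp: in_keys_iff)

lemma monom_subst_add: "monom_subst g (m + n) = monom_subst g m * monom_subst g n"
proof -
  let ?A = "Poly_Mapping.keys m \<union> Poly_Mapping.keys n"
  have "monom_subst g (m + n) = (\<Prod>x\<in>?A. g x ^ Poly_Mapping.lookup (m + n) x)"
    by (rule monom_subst_superset) (auto simp: Poly_Mapping.keys_add)
  also have "\<dots> = (\<Prod>x\<in>?A. g x ^ Poly_Mapping.lookup m x) * (\<Prod>x\<in>?A. g x ^ Poly_Mapping.lookup n x)"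
    by (simp add: lookup_add power_add prod.distrib)
  finally show ?thesis
    by (simp add: monom_subst_superset[of ?A])
qed

text \<open>Terms with coefficient 0 contribute nothing, so one index set serves \<open>p\<close>,
  \<open>q\<close> and \<open>p + q\<close> even when terms of the sum cancel.\<close>

lemma poly_subst_superset:
  assumes "finite A" "Poly_Mapping.keys p \<subseteq> A"
  shows "poly_subst g p = (\<Sum>m\<in>A. Const (Poly_Mapping.lookup p m) * monom_subst g m)"
  unfolding poly_subst_def monom_subst_def
  using assms by (intro sum.mono_neutral_left) (auto simp: in_keys_iff Const_def)

lemma Const_add: "Const (c + d) = Const c + Const d"
  by (simp add: Const_def single_add)

lemma Const_mult: "Const (c * d) = Const c * Const d"
  by (simp add: Const_def mult_single)

lemma Const_1: "Const 1 = 1"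
  by (simp add: Const_def)

lemma poly_subst_add: "poly_subst g (p + q) = poly_subst g p + poly_subst g q"
proof -
  let ?A = "Poly_Mapping.keys p \<union> Poly_Mapping.keys q"
  have "poly_subst g (p + q) = (\<Sum>m\<in>?A. Const (Poly_Mapping.lookup (p + q) m) * monom_subst g m)"
    by (rule poly_subst_superset) (auto simp: Poly_Mapping.keys_add)
  also have "\<dots> = (\<Sum>m\<in>?A. Const (Poly_Mapping.lookup p m) * monom_subst g m)
      + (\<Sum>m\<in>?A. Const (Poly_Mapping.lookup q m) * monom_subst g m)"
    by (simp add: lookup_add Const_add distrib_right sum.distrib)
  finally show ?thesis
    by (simp add: poly_subst_superset[of ?A])
qed

lemma poly_subst_0: "poly_subst g 0 = 0"
  by (simp add: poly_subst_def)

lemma poly_subst_single: "poly_subst g (Poly_Mapping.single m c) = Const c * monom_subst g m"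
  by (subst poly_subst_superset[of "{m}"]) (auto simp: lookup_single)

lemma poly_subst_sum: "poly_subst g (\<Sum>i\<in>A. f i) = (\<Sum>i\<in>A. poly_subst g (f i))"
  by (induction A rule: infinite_finite_induct) (auto simp: poly_subst_0 poly_subst_add)

lemma poly_mapping_sum_single:
  "p = (\<Sum>m\<in>Poly_Mapping.keys p. Poly_Mapping.single m (Poly_Mapping.lookup p m))"
  by (rule poly_mapping_eqI) (auto simp: lookup_sum lookup_single when_def in_keys_iff)

lemma poly_subst_mult: "poly_subst g (p * q) = poly_subst g p * poly_subst g q"
proof -
  let ?s = "\<lambda>p m. Poly_Mapping.single m (Poly_Mapping.lookup p m)"
  have "p * q = (\<Sum>m\<in>Poly_Mapping.keys p. ?s p m) * (\<Sum>n\<in>Poly_Mapping.keys q. ?s q n)"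
    using poly_mapping_sum_single[of p] poly_mapping_sum_single[of q] by simp
  also have "\<dots> = (\<Sum>m\<in>Poly_Mapping.keys p. \<Sum>n\<in>Poly_Mapping.keys q. ?s p m * ?s q n)"
    by (rule sum_product)
  finally have "poly_subst g (p * q) =
      (\<Sum>m\<in>Poly_Mapping.keys p. \<Sum>n\<in>Poly_Mapping.keys q. poly_subst g (?s p m * ?s q n))"
    by (simp add: poly_subst_sum)
  also have "\<dots> = (\<Sum>m\<in>Poly_Mapping.keys p. \<Sum>n\<in>Poly_Mapping.keys q.
      (Const (Poly_Mapping.lookup p m) * monom_subst g m) *
      (Const (Poly_Mapping.lookup q n) * monom_subst g n))"
    by (simp add: mult_single poly_subst_single monom_subst_add Const_mult mult_ac)
  also have "\<dots> = poly_subst g p * poly_subst g q"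
    by (simp add: sum_product poly_subst_def monom_subst_def)
  finally show ?thesis .
qed

lemma poly_subst_Const: "poly_subst g (Const c) = Const c"
proof -
  have "poly_subst g (Poly_Mapping.single 0 c) = Const c"
    by (simp add: poly_subst_single monom_subst_def)
  then show ?thesis
    by (simp add: Const_def)
qed

lemma poly_subst_1: "poly_subst g 1 = 1"
  using poly_subst_Const[of g 1] by (simp add: Const_1)

lemma poly_subst_Var: "poly_subst g (Var x) = g x"
  by (simp add: Var_def poly_subst_single monom_subst_def Const_1)

lemma poly_subst_diff: "poly_subst g (p - q) = poly_subst g p - poly_subst g q"
  using poly_subst_add[of g "p - q" q] by simp

lemma poly_subst_power: "poly_subst g (p ^ n) = poly_subst g p ^ n"
  by (induction n) (auto simp: poly_subst_1 poly_subst_mult)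

lemma poly_subst_prod: "poly_subst g (\<Prod>i\<in>A. f i) = (\<Prod>i\<in>A. poly_subst g (f i))"
  by (induction A rule: infinite_finite_induct) (auto simp: poly_subst_1 poly_subst_mult)

text \<open>Used to merge the renaming of lattice points into edges with a later map on edge
  variables, so that both act as one substitution on the polyomino ring.\<close>

lemma poly_subst_poly_subst:
  "poly_subst g (poly_subst h p) = poly_subst (\<lambda>x. poly_subst g (h x)) p"
  by (simp add: poly_subst_def[of h] poly_subst_def[of "\<lambda>x. poly_subst g (h x)"] poly_subst_sum
      poly_subst_mult poly_subst_prod poly_subst_power poly_subst_Const)

subsection \<open>Polynomial rings over a set of variables\<close>

lemma polys_over_add: "p \<in> polys_over X \<Longrightarrow> q \<in> polys_over X \<Longrightarrow> p + q \<in> polys_over X"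
  using Poly_Mapping.keys_add[of p q] by (auto simp: polys_over_def)

lemma polys_over_diff: "p \<in> polys_over X \<Longrightarrow> q \<in> polys_over X \<Longrightarrow> p - q \<in> polys_over X"
  using keys_diff[of p q] by (auto simp: polys_over_def)

lemma polys_over_0: "0 \<in> polys_over X"
  by (simp add: polys_over_def)

lemma polys_over_1: "1 \<in> polys_over X"
  by (simp add: polys_over_def)

lemma polys_over_mult:
  assumes "p \<in> polys_over X" "q \<in> polys_over X"
  shows "p * q \<in> polys_over X"
  unfolding polys_over_def
proof (intro CollectI ballI)
  fix k assume "k \<in> Poly_Mapping.keys (p * q)"
  then obtain m n where "m \<in> Poly_Mapping.keys p" "n \<in> Poly_Mapping.keys q" "k = m + n"
    using keys_mult[of p q] by blast
  moreover have "Poly_Mapping.keys m \<subseteq> X" "Poly_Mapping.keys n \<subseteq> X"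
    using calculation assms by (auto simp: polys_over_def)
  ultimately show "Poly_Mapping.keys k \<subseteq> X"
    using Poly_Mapping.keys_add[of m n] by blast
qed

lemma polys_over_Var: "x \<in> X \<Longrightarrow> Var x \<in> polys_over X"
  by (simp add: polys_over_def Var_def)

lemma polys_over_UNIV: "polys_over UNIV = UNIV"
  by (simp add: polys_over_def)

lemma cring_poly_ring: "cring (poly_ring X)"
proof (rule cringI)
  show "abelian_group (poly_ring X)"
  proof (rule abelian_groupI)
    fix p assume "p \<in> carrier (poly_ring X)"
    then have "0 - p \<in> carrier (poly_ring X)"
      using polys_over_diff[OF polys_over_0] by (simp add: poly_ring_def)
    then show "\<exists>q\<in>carrier (poly_ring X). q \<oplus>\<^bsub>poly_ring X\<^esub> p = \<zero>\<^bsub>poly_ring X\<^esub>"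
      by (intro bexI[of _ "0 - p"]) (auto simp: poly_ring_def)
  qed (auto simp: poly_ring_def polys_over_add polys_over_0 ac_simps)
  show "comm_monoid (poly_ring X)"
    by (rule comm_monoidI) (auto simp: poly_ring_def polys_over_mult polys_over_1 ac_simps)
qed (auto simp: poly_ring_def algebra_simps)

text \<open>The kernel of a ring homomorphism is an ideal, and the generated ideal is the least one
  containing \<open>S\<close>. Taking all variables in the target ring leaves \<open>g\<close>
  unrestricted.\<close>

lemma poly_subst_vanishes_on_genideal:
  fixes g :: "'x \<Rightarrow> ('y, 'k::field) mpoly"
  assumes "S \<subseteq> polys_over X" and "\<And>p. p \<in> S \<Longrightarrow> poly_subst g p = 0"
    and "p \<in> Idl\<^bsub>poly_ring X\<^esub> S"
  shows "poly_subst g p = 0"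
proof -
  let ?R = "poly_ring X :: ('x, 'k) mpoly ring" and ?T = "poly_ring UNIV :: ('y, 'k) mpoly ring"
  interpret R: cring ?R by (rule cring_poly_ring)
  interpret T: cring ?T by (rule cring_poly_ring)
  interpret h: ring_hom_ring ?R ?T "poly_subst g"
    by (rule ring_hom_ringI[OF R.ring_axioms T.ring_axioms])
      (simp_all add: poly_ring_def polys_over_UNIV poly_subst_add poly_subst_mult poly_subst_1)
  have ker: "a_kernel ?R ?T (poly_subst g) = {p \<in> polys_over X. poly_subst g p = 0}"
    unfolding a_kernel_def' by (simp add: poly_ring_def)
  have "Idl\<^bsub>?R\<^esub> S \<subseteq> a_kernel ?R ?T (poly_subst g)"
  proof (rule R.genideal_minimal[OF h.kernel_is_ideal])
    show "S \<subseteq> a_kernel ?R ?T (poly_subst g)"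
      unfolding ker using assms(1,2) by blast
  qed
  with assms(3) show ?thesis
    unfolding ker by blast
qed

subsection \<open>Quadratic binomials in a toric ideal\<close>

lemma prod_Var:
  "finite e \<Longrightarrow> (\<Prod>i\<in>e. Var i) = Poly_Mapping.single (\<Sum>i\<in>e. Poly_Mapping.single i 1) 1"
  by (induction e rule: finite_induct) (auto simp: Var_def mult_single)

text \<open>Both sides are single monomials with coefficient 1, so their exponents agree; the
  exponent of \<open>i\<close> counts how many of the two edges contain \<open>i\<close>.\<close>

lemma prod_Var_mult_eqD:
  assumes "(\<Prod>i\<in>p. Var i) * (\<Prod>i\<in>q. Var i) = (\<Prod>i\<in>r. Var i) * (\<Prod>i\<in>s. Var i :: ('v, 'k::field) mpoly)"
    and "finite p" "finite q" "finite r" "finite s"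
  shows "of_bool (i \<in> p) + of_bool (i \<in> q) = (of_bool (i \<in> r) + of_bool (i \<in> s) :: nat)"
proof -
  let ?m = "\<lambda>e. \<Sum>i\<in>e. Poly_Mapping.single i (1::nat)"
  have look: "Poly_Mapping.lookup (?m e) i = of_bool (i \<in> e)" if "finite e" for e
    using that by (auto simp: lookup_sum lookup_single when_def of_bool_def)
  have "Poly_Mapping.single (?m p + ?m q) (1::'k) = Poly_Mapping.single (?m r + ?m s) 1"
    using assms by (simp add: prod_Var mult_single)
  then have "Poly_Mapping.lookup (Poly_Mapping.single (?m p + ?m q) (1::'k)) (?m r + ?m s) = 1"
    by simp
  then have "?m p + ?m q = ?m r + ?m s"
    by (auto simp: lookup_single when_def split: if_splits)
  then have "Poly_Mapping.lookup (?m p + ?m q) i = Poly_Mapping.lookup (?m r + ?m s) i"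
    by simp
  then show ?thesis
    using assms look by (simp add: lookup_add)
qed

text \<open>The edges \<open>p, r, s, q\<close> form a 4-cycle in which \<open>p, s\<close> and \<open>q, r\<close> are the opposite pairs.\<close>

definition four_cycle :: "'v set \<Rightarrow> 'v set \<Rightarrow> 'v set \<Rightarrow> 'v set \<Rightarrow> bool" where
  "four_cycle p q r s \<longleftrightarrow> card p = 2 \<and> card q = 2 \<and> card r = 2 \<and> card s = 2 \<and>
     p \<noteq> q \<and> p \<noteq> r \<and> q \<noteq> s \<and> r \<noteq> s \<and> p \<inter> s = {} \<and> q \<inter> r = {} \<and> p \<union> s = q \<union> r"

lemma four_cycleI:
  assumes card: "card p = 2" "card q = 2" "card r = 2" "card s = 2"
    and "p \<noteq> q" "p \<noteq> r" "q \<noteq> s" "r \<noteq> s"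
    and cnt: "\<And>i. of_bool (i \<in> p) + of_bool (i \<in> s) = (of_bool (i \<in> q) + of_bool (i \<in> r) :: nat)"
  shows "four_cycle p q r s"
proof -
  \<comment> \<open>The counts take values 0, 1, 2: being positive describes the union, being 2 the
    intersection.\<close>
  have un: "i \<in> p \<or> i \<in> s \<longleftrightarrow> i \<in> q \<or> i \<in> r" and int: "i \<in> p \<and> i \<in> s \<longleftrightarrow> i \<in> q \<and> i \<in> r" for i
    using cnt[of i] by (auto simp: of_bool_def split: if_splits)
  have "p \<inter> s = {}"
  proof (rule ccontr)
    assume "p \<inter> s \<noteq> {}"
    then obtain i where i: "i \<in> p" "i \<in> s" "i \<in> q" "i \<in> r"
      using int by blast
    then obtain j where "p = {i, j}"
      using card(1) by (auto simp: card_2_iff)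
    \<comment> \<open>A common vertex of \<open>p\<close> and \<open>s\<close> lies on all four
      edges, so the other end of \<open>p\<close> forces \<open>p\<close> to equal \<open>q\<close>
      or \<open>r\<close>.\<close>
    moreover have "j \<in> q \<or> j \<in> r"
      using un[of j] calculation by blast
    ultimately have "p \<subseteq> q \<or> p \<subseteq> r"
      using i by blast
    moreover have "finite q" "finite r"
      using card by (auto intro: card_ge_0_finite)
    ultimately show False
      using card assms(5,6) by (metis card_subset_eq)
  qed
  moreover have "q \<inter> r = {}"
    using calculation int by blast
  moreover have "p \<union> s = q \<union> r"
    using un by blast
  ultimately show ?thesis
    using assms by (simp add: four_cycle_def)
qed

text \<open>The arguments stand for the lower left, lower right, upper left and upper right corner;
  this is the left-right reflection, and \<open>four_cycle_transpose\<close> the reflection in the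
  diagonal.\<close>

lemma four_cycle_flip: "four_cycle p q r s \<Longrightarrow> four_cycle q p s r"
  by (simp add: four_cycle_def eq_commute)

lemma four_cycle_transpose: "four_cycle p q r s \<Longrightarrow> four_cycle p r q s"
  by (simp add: four_cycle_def Int_commute Un_commute)

text \<open>The two ends of \<open>p\<close> are covered by \<open>q\<close> and \<open>r\<close>,
  but neither covers both, so each contains exactly one end.\<close>

lemma four_cycle_share:
  assumes "four_cycle p q r s"
  obtains h where "p \<inter> q = {h}"
proof -
  have card: "card p = 2" "card q = 2" "card r = 2" and ne: "p \<noteq> q" "p \<noteq> r"
    and sub: "p \<subseteq> q \<union> r"
    using assms by (auto simp: four_cycle_def)
  then have fin: "finite p" "finite q" "finite r"
    by (auto intro: card_ge_0_finite)
  have "\<not> p \<subseteq> q" "\<not> p \<subseteq> r"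
    using card_subset_eq[OF fin(2)] card_subset_eq[OF fin(3)] card ne by auto
  moreover obtain i j where "p = {i, j}"
    using card(1) by (auto simp: card_2_iff)
  ultimately have "p \<inter> q = {i} \<or> p \<inter> q = {j}"
    using sub by auto
  then show ?thesis
    using that by blast
qed

text \<open>The vertex \<open>h\<close> lies on \<open>p2\<close>, hence not on the opposite edge
  \<open>q1\<close>; in the second cycle \<open>p3\<close> and \<open>q1\<close> cover
  \<open>p1\<close>, so \<open>h\<close> must lie on \<open>p3\<close>. Thus a shared vertex
  propagates along a whole row.\<close>

lemma four_cycle_star:
  assumes "four_cycle p1 p2 q1 q2" "four_cycle p1 p3 q1 q3" "h \<in> p1" "h \<in> p2"
  shows "h \<in> p3"
proof -
  have "p1 \<subseteq> p3 \<union> q1" "p2 \<inter> q1 = {}"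
    using assms(1,2) by (auto simp: four_cycle_def)
  then show ?thesis
    using assms(3,4) by blast
qed

subsection \<open>The corners of a labelled frame\<close>

definition box_cycle :: "(nat \<Rightarrow> nat \<Rightarrow> 'v set) \<Rightarrow> nat \<Rightarrow> nat \<Rightarrow> nat \<Rightarrow> nat \<Rightarrow> bool" where
  "box_cycle e x x' y y' \<longleftrightarrow> four_cycle (e x y) (e x' y) (e x y') (e x' y')"

lemma box_cycle_flip_x: "box_cycle e x x' y y' \<Longrightarrow> box_cycle e x' x y y'"
  unfolding box_cycle_def by (rule four_cycle_flip)

lemma box_cycle_flip_y: "box_cycle e x x' y y' \<Longrightarrow> box_cycle e x x' y' y"
  unfolding box_cycle_def by (rule four_cycle_transpose[OF four_cycle_flip[OF four_cycle_transpose]])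

text \<open>The corner box splits the label into an end \<open>h\<close> shared horizontally and an
  end \<open>w\<close> shared vertically; they differ because the two neighbours are opposite edges
  of the cycle. The star property carries \<open>h\<close> to \<open>x2\<close> and \<open>w\<close>
  to \<open>y2\<close>.\<close>

lemma box_cycle_corner:
  assumes "box_cycle e x x1 y y1" "box_cycle e x x2 y y1" "box_cycle e x x1 y y2"
  obtains h w where "e x y = {h, w}" "h \<noteq> w" "h \<in> e x2 y" "w \<in> e x y2"
proof -
  have c: "four_cycle (e x y) (e x1 y) (e x y1) (e x1 y1)"
    using assms(1) by (simp add: box_cycle_def)
  obtain h where h: "e x y \<inter> e x1 y = {h}"
    using four_cycle_share[OF c] .
  obtain w where w: "e x y \<inter> e x y1 = {w}"
    using four_cycle_share[OF four_cycle_transpose[OF c]] .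
  have "h \<in> e x y" "h \<in> e x1 y" "w \<in> e x y" "w \<in> e x y1"
    using h w by blast+
  then have "h \<in> e x2 y" "w \<in> e x y2"
    using four_cycle_star[OF c assms(2)[unfolded box_cycle_def]]
      four_cycle_star[OF four_cycle_transpose[OF c]
        four_cycle_transpose[OF assms(3)[unfolded box_cycle_def]]]
    by blast+
  moreover have "e x1 y \<inter> e x y1 = {}"
    using c by (simp add: four_cycle_def)
  then have "h \<noteq> w"
    using h w by blast
  moreover have "e x y = {h, w}"
  proof -
    have "card (e x y) = 2"
      using c by (simp add: four_cycle_def)
    moreover have "h \<in> e x y" "w \<in> e x y"
      using h w by blast+
    ultimately show ?thesis
      using \<open>h \<noteq> w\<close> by (auto simp: card_2_iff)
  qed
  ultimately show ?thesis
    using that by blast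
qed

text \<open>
  Neighbouring corners share a graph vertex because of the strip along the side between them, so the
  four corner labels form a closed walk of length 4.
\<close>

lemma frame_corners_prod:
  fixes g :: "'v \<Rightarrow> 'r::comm_monoid_mult"
  assumes "box_cycle e x0 x1 y0 y1" "box_cycle e x2 x3 y0 y1"
    and "box_cycle e x0 x1 y2 y3" "box_cycle e x2 x3 y2 y3"
    and "box_cycle e x0 x3 y0 y1" "box_cycle e x0 x3 y2 y3"
    and "box_cycle e x0 x1 y0 y3" "box_cycle e x2 x3 y0 y3"
  shows "prod g (e x0 y0) * prod g (e x3 y3) = prod g (e x0 y3) * prod g (e x3 y0)"
proof -
  note fx = box_cycle_flip_x and fy = box_cycle_flip_y
  obtain h w where A: "e x0 y0 = {h, w}" "h \<noteq> w" "h \<in> e x3 y0" "w \<in> e x0 y3"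
    using box_cycle_corner[OF assms(1) assms(5) assms(7)] .
  \<comment> \<open>The other three corners are reflected into lower left position; each
    \<open>h\<close> points along the horizontal side and each \<open>w\<close> along the vertical
    one.\<close>
  obtain h1 w1 where B: "e x3 y0 = {h1, w1}" "h1 \<noteq> w1" "h1 \<in> e x0 y0" "w1 \<in> e x3 y3"
    using box_cycle_corner[OF fx[OF assms(2)] fx[OF assms(5)] fx[OF assms(8)]] .
  obtain h2 w2 where C: "e x0 y3 = {h2, w2}" "h2 \<noteq> w2" "h2 \<in> e x3 y3" "w2 \<in> e x0 y0"
    using box_cycle_corner[OF fy[OF assms(3)] fy[OF assms(6)] fy[OF assms(7)]] .
  obtain h3 w3 where D: "e x3 y3 = {h3, w3}" "h3 \<noteq> w3" "h3 \<in> e x0 y3" "w3 \<in> e x3 y0"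
    using box_cycle_corner[OF fx[OF fy[OF assms(4)]] fx[OF fy[OF assms(6)]] fx[OF fy[OF assms(8)]]] .
  have unique: "u = v" if "box_cycle e x x' y y'" "u \<in> e x y" "u \<in> e x' y" "v \<in> e x y" "v \<in> e x' y"
    for x x' y y' u v
    using that four_cycle_share unfolding box_cycle_def by (metis IntI singletonD)
  have unique': "u = v" if "box_cycle e x x' y y'" "u \<in> e x y" "u \<in> e x y'" "v \<in> e x y" "v \<in> e x y'"
    for x x' y y' u v
    using that four_cycle_share[OF four_cycle_transpose] unfolding box_cycle_def
    by (metis IntI singletonD)
  \<comment> \<open>Adjacent labels meet in one vertex, so the ends found from the two corners of a
    side agree. The labels become \<open>{h, w}\<close>, \<open>{h, w1}\<close>,
    \<open>{h2, w}\<close>, \<open>{h2, w1}\<close>, and both products use each of \<open>h\<close>,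
    \<open>w\<close>, \<open>h2\<close>, \<open>w1\<close> once.\<close>
  have "h1 = h"
    using unique[OF assms(5)] A B by blast
  moreover have "w2 = w"
    using unique'[OF assms(7)] A C by blast
  moreover have "h3 = h2"
    using unique[OF fy[OF assms(6)]] C D by blast
  moreover have "w3 = w1"
    using unique'[OF fx[OF assms(8)]] B D by blast
  ultimately show ?thesis
    using A(1,2) B(1,2) C(1,2) D(1,2) by (simp add: ac_simps)
qed

subsection \<open>Inner intervals\<close>

lemma cell_subset_iff: "cell c \<subseteq> {p..q} \<longleftrightarrow> p \<le> c \<and> c + (1, 1) \<le> q"
  by (auto simp: cell_def atLeastatMost_subset_iff less_eq_prod_def)

lemma inner_interval_corners:
  assumes "p \<prec> q" "cells_in p q \<subseteq> Q"
  shows "p \<in> vertices Q" "q \<in> vertices Q" "(fst p, snd q) \<in> vertices Q" "(fst q, snd p) \<in> vertices Q"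
proof -
  have v: "v \<in> vertices Q" if "v \<in> cell c" "p \<le> c" "c + (1, 1) \<le> q" for v c
    using that assms(2) cell_subset_iff[of c p q]
    unfolding vertices_def cells_in_def is_cell_def by blast
  obtain p1 p2 q1 q2 where pq: "p = (p1, p2)" "q = (q1, q2)" "p1 < q1" "p2 < q2"
    using assms(1) by (cases p; cases q) (auto simp: strictly_below_def)
  show "p \<in> vertices Q"
    by (rule v[of _ p]) (use pq in \<open>auto simp: cell_def\<close>)
  \<comment> \<open>Each corner is a vertex of the cell of the interval at that corner; the
    subtractions do not truncate, as \<open>p1 < q1\<close> and \<open>p2 < q2\<close>.\<close>
  show "q \<in> vertices Q"
    by (rule v[of _ "(q1 - 1, q2 - 1)"]) (use pq in \<open>auto simp: cell_def\<close>)
  show "(fst p, snd q) \<in> vertices Q"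
    by (rule v[of _ "(p1, q2 - 1)"]) (use pq in \<open>auto simp: cell_def\<close>)
  show "(fst q, snd p) \<in> vertices Q"
    by (rule v[of _ "(q1 - 1, p2)"]) (use pq in \<open>auto simp: cell_def\<close>)
qed

text \<open>A cell of \<open>P\<close> has its lower left and upper right corners strictly inside
  \<open>[a,b]\<close>, whereas in a strip of width at most 1 along a side one of these two corners
  touches that side.\<close>

lemma boundary_strip_subset:
  assumes "avoids_boundary P a b" "a \<le> p" "q \<le> b"
    and strip: "fst q \<le> fst a + 1 \<or> snd q \<le> snd a + 1 \<or> fst b \<le> fst p + 1 \<or> snd b \<le> snd p + 1"
  shows "cells_in p q \<subseteq> cells_in a b - P"
proof
  fix C assume "C \<in> cells_in p q"
  then obtain c where c: "C = cell c" "p \<le> c" "c + (1, 1) \<le> q"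
    by (auto simp: cells_in_def is_cell_def cell_subset_iff)
  have "C \<notin> P"
  proof
    assume "C \<in> P"
    moreover have "c \<in> cell c" "c + (1, 1) \<in> cell c"
      by (cases c; simp add: cell_def)+
    ultimately have "c \<in> vertices P" "c + (1, 1) \<in> vertices P"
      using c(1) by (auto simp: vertices_def)
    then have "a \<prec> c" "c + (1, 1) \<prec> b"
      using assms(1) by (auto simp: avoids_boundary_def)
    with c strip show False
      by (auto simp: strictly_below_def less_eq_prod_def)
  qed
  moreover have "a \<le> c" "c + (1, 1) \<le> b"
    using c assms(2,3) by (meson order_trans)+
  then have "C \<in> cells_in a b"
    unfolding cells_in_def is_cell_def using c(1) cell_subset_iff by blast
  ultimately show "C \<in> cells_in a b - P" by blast
qed

lemma inner_minors_subset: "inner_minors Q \<subseteq> polys_over (vertices Q)"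
proof
  fix f :: "(point, 'k::field) mpoly"
  assume "f \<in> inner_minors Q"
  then obtain p q where "f = inner_minor p q" "p \<prec> q" "cells_in p q \<subseteq> Q"
    by (auto simp: inner_minors_def)
  with inner_interval_corners[of p q Q] show "f \<in> polys_over (vertices Q)"
    by (simp add: inner_minor_def polys_over_diff polys_over_mult polys_over_Var)
qed

lemma toric_ideal_iff:
  "f \<in> (toric_ideal V E :: ('v set, 'k::field) mpoly set) \<longleftrightarrow>
     f \<in> polys_over E \<and> poly_subst (\<lambda>e. \<Prod>i\<in>e. Var i) f = (0 :: ('v, 'k) mpoly)"
  by (simp add: toric_ideal_def a_kernel_def' poly_ring_def)

text \<open>The renamed minor lies in the kernel, so opposite corners give equal products of graph
  variables. Adjacent corners are distinct points and carry distinct edges by injectivity, which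
  leaves only a 4-cycle.\<close>

lemma inner_minor_four_cycle:
  fixes V :: "'v set"
  assumes "finite_simple_graph V E" and bij: "bij_betw \<phi> (vertices Q) E"
    and img: "poly_subst (\<lambda>x. Var (\<phi> x)) ` (polyomino_ideal Q :: (point, 'k::field) mpoly set)
      = toric_ideal V E"
    and pq: "p \<prec> q" "cells_in p q \<subseteq> Q"
  shows "four_cycle (\<phi> p) (\<phi> (fst q, snd p)) (\<phi> (fst p, snd q)) (\<phi> q)"
proof -
  let ?m = "inner_minor p q :: (point, 'k) mpoly" and ?g = "\<lambda>e. \<Prod>i\<in>e. Var i :: ('v, 'k) mpoly"
  note X = inner_interval_corners[OF pq]
  have card: "card (\<phi> x) = 2" if "x \<in> vertices Q" for x
    using that assms(1) bij by (auto simp: finite_simple_graph_def dest: bij_betwE)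
  have fin: "finite (\<phi> x)" if "x \<in> vertices Q" for x
    using card[OF that] by (auto intro: card_ge_0_finite)
  have inj: "\<phi> x \<noteq> \<phi> y" if "x \<in> vertices Q" "y \<in> vertices Q" "x \<noteq> y" for x y
    using that bij by (auto simp: bij_betw_def dest: inj_onD)
  have "?m \<in> inner_minors Q"
    using pq unfolding inner_minors_def by blast
  then have "?m \<in> polyomino_ideal Q"
    unfolding polyomino_ideal_def genideal_def by blast
  then have "poly_subst (\<lambda>x. Var (\<phi> x)) ?m \<in> toric_ideal V E"
    using img by blast
  then have "poly_subst (\<lambda>x. ?g (\<phi> x)) ?m = 0"
    by (simp add: toric_ideal_iff poly_subst_poly_subst poly_subst_Var)
  then have "?g (\<phi> p) * ?g (\<phi> q) = ?g (\<phi> (fst p, snd q)) * ?g (\<phi> (fst q, snd p))"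
    by (simp add: inner_minor_def poly_subst_diff poly_subst_mult poly_subst_Var)
  then have "of_bool (i \<in> \<phi> p) + of_bool (i \<in> \<phi> q) =
      (of_bool (i \<in> \<phi> (fst p, snd q)) + of_bool (i \<in> \<phi> (fst q, snd p)) :: nat)" for i
    by (rule prod_Var_mult_eqD) (use fin X in auto)
  moreover have "p \<noteq> (fst q, snd p)" "p \<noteq> (fst p, snd q)" "(fst q, snd p) \<noteq> q" "(fst p, snd q) \<noteq> q"
    using pq(1) by (cases p; cases q; simp add: strictly_below_def)+
  ultimately show ?thesis
    using X by (intro four_cycleI card inj) (simp_all add: add.commute)
qed

theorem theorem3p1:
  fixes a b :: point and P :: "point set set"
    and V :: "'v set" and E :: "'v set set"
  assumes "a \<prec> b"
    and "subpolyomino P (cells_in a b)"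
    and "simple_polyomino P"
    and "polyomino (cells_in a b - P)"
    and "P \<noteq> {}"
    and "avoids_boundary P a b"
    and "finite_simple_graph V E"
  shows "\<not> coincides_with_toric_ideal (vertices (cells_in a b - P))
           (polyomino_ideal (cells_in a b - P) :: (point, 'k::field) mpoly set) V E"
proof
  let ?Q = "cells_in a b - P"
  let ?I = "polyomino_ideal ?Q :: (point, 'k) mpoly set"
  assume "coincides_with_toric_ideal (vertices ?Q) ?I V E"
  then obtain \<phi> where bij: "bij_betw \<phi> (vertices ?Q) E"
    and img: "poly_subst (\<lambda>x. Var (\<phi> x)) ` ?I = toric_ideal V E"
    by (auto simp: coincides_with_toric_ideal_def)
  obtain a1 a2 b1 b2 where ab: "a = (a1, a2)" "b = (b1, b2)" "a1 < b1" "a2 < b2"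
    using assms(1) by (cases a; cases b) (auto simp: strictly_below_def)
  let ?c = "(a1, b2)" and ?d = "(b1, a2)"
  let ?e = "\<lambda>x y. \<phi> (x, y)"
  have strip: "cells_in (x, y) (x', y') \<subseteq> ?Q"
    if "a1 \<le> x" "a2 \<le> y" "x' \<le> b1" "y' \<le> b2"
      "x' \<le> a1 + 1 \<or> y' \<le> a2 + 1 \<or> b1 \<le> x + 1 \<or> b2 \<le> y + 1" for x x' y y'
    by (rule boundary_strip_subset[OF assms(6)]) (use that ab in auto)
  have box: "box_cycle ?e x x' y y'"
    if "x < x'" "y < y'" "a1 \<le> x" "a2 \<le> y" "x' \<le> b1" "y' \<le> b2"
      "x' \<le> a1 + 1 \<or> y' \<le> a2 + 1 \<or> b1 \<le> x + 1 \<or> b2 \<le> y + 1" for x x' y y'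
    using inner_minor_four_cycle[OF assms(7) bij img, of "(x, y)" "(x', y')"] strip that
    by (simp add: box_cycle_def strictly_below_def)
  have "a \<in> vertices ?Q" "?d \<in> vertices ?Q"
    using inner_interval_corners[OF _ strip[of a1 a2 b1 "a2 + 1"]] ab
    by (simp_all add: strictly_below_def)
  moreover have "?c \<in> vertices ?Q" "b \<in> vertices ?Q"
    using inner_interval_corners[OF _ strip[of a1 "b2 - 1" b1 b2]] ab
    by (simp_all add: strictly_below_def)
  ultimately have X: "a \<in> vertices ?Q" "b \<in> vertices ?Q" "?c \<in> vertices ?Q" "?d \<in> vertices ?Q"
    by blast+
  have phi_eq: "\<phi> x = \<phi> y \<longleftrightarrow> x = y" if "x \<in> vertices ?Q" "y \<in> vertices ?Q" for x y
    using that bij by (auto simp: bij_betw_def dest: inj_onD)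
  let ?f = "Var (\<phi> a) * Var (\<phi> b) - Var (\<phi> ?c) * Var (\<phi> ?d) :: ('v set, 'k) mpoly"
  \<comment> \<open>The chosen coordinates cut off a strip of width 1 at each side: four corner
    boxes and four full strips, all inner intervals.\<close>
  have prod: "(\<Prod>i\<in>\<phi> a. Var i) * (\<Prod>i\<in>\<phi> b. Var i) =
      (\<Prod>i\<in>\<phi> ?c. Var i) * (\<Prod>i\<in>\<phi> ?d. Var i :: ('v, 'k) mpoly)"
    unfolding ab
    by (rule frame_corners_prod[of ?e a1 "a1 + 1" a2 "a2 + 1" "b1 - 1" b1 "b2 - 1" b2])
      (rule box; use ab in auto)+
  have "?f \<in> toric_ideal V E"
  proof -
    have "\<phi> v \<in> E" if "v \<in> vertices ?Q" for v
      using bij_betwE[OF bij] that by blast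
    then have "?f \<in> polys_over E"
      using X by (simp add: polys_over_diff polys_over_mult polys_over_Var)
    with prod show ?thesis
      by (simp add: toric_ideal_iff poly_subst_diff poly_subst_mult poly_subst_Var)
  qed
  then obtain f where f: "f \<in> ?I" "poly_subst (\<lambda>x. Var (\<phi> x)) f = ?f"
    unfolding img[symmetric] by (elim imageE) simp
  \<comment> \<open>Evaluate at the point whose coordinates are 1 at \<open>a\<close>, \<open>b\<close> and 0 elsewhere: since \<open>[a, b]\<close>
    is not an inner interval, every inner minor vanishes there, term by term.\<close>
  let ?g = "\<lambda>e. of_bool (e \<in> {\<phi> a, \<phi> b}) :: ('v set, 'k) mpoly"
  have "poly_subst (\<lambda>x. ?g (\<phi> x)) m = 0" if mem: "m \<in> inner_minors ?Q" for m
  proof -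
    obtain p q where m: "m = inner_minor p q" and pq: "p \<prec> q" "cells_in p q \<subseteq> ?Q"
      using mem unfolding inner_minors_def by blast
    note Y = inner_interval_corners[OF pq]
    have g: "?g (\<phi> x) = of_bool (x = a \<or> x = b)" if "x \<in> vertices ?Q" for x
      using that X phi_eq by simp
    \<comment> \<open>Otherwise all cells of \<open>[a,b]\<close> would avoid \<open>P\<close>,
      although \<open>P\<close> is nonempty and contained in them.\<close>
    have "\<not> (p = a \<and> q = b)"
      using pq assms(2,5) by (auto simp: subpolyomino_def)
    then have "?g (\<phi> p) * ?g (\<phi> q) = 0"
      using pq(1) ab unfolding g[OF Y(1)] g[OF Y(2)] by (auto simp: strictly_below_def)
    \<comment> \<open>Anti-diagonal corners are distinct and incomparable, so they cannot both lie
      in \<open>{a, b}\<close> with \<open>a \<prec> b\<close>.\<close>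
    moreover have "?g (\<phi> (fst p, snd q)) * ?g (\<phi> (fst q, snd p)) = 0"
      using pq(1) ab unfolding g[OF Y(3)] g[OF Y(4)] by (auto simp: strictly_below_def)
    ultimately show ?thesis
      unfolding m inner_minor_def poly_subst_diff poly_subst_mult poly_subst_Var by simp
  qed
  then have "poly_subst (\<lambda>x. ?g (\<phi> x)) f = 0"
    by (rule poly_subst_vanishes_on_genideal[OF inner_minors_subset])
      (use f(1) in \<open>simp_all add: polyomino_ideal_def\<close>)
  moreover have "poly_subst ?g ?f = poly_subst (\<lambda>x. ?g (\<phi> x)) f"
    unfolding f(2)[symmetric] poly_subst_poly_subst poly_subst_Var ..
  \<comment> \<open>The first term has value 1 and the second 0, since \<open>?c\<close> and
    \<open>?d\<close> differ from \<open>a\<close> and \<open>b\<close>. This contradicts the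
    vanishing on the ideal.\<close>
  moreover have "poly_subst ?g ?f = 1"
    using X phi_eq ab by (simp add: poly_subst_diff poly_subst_mult poly_subst_Var)
  ultimately show False
    by simp
qed

end
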